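(* Let $n\ge2$ and $3\le k\le n+1$ be integers, and let $c_1,c_2,\dots,c_l\in\{1,\dots,k\}$ be distinct integers, where $l\ge 3$. For any $\mathrm{OA}(k,n)$ we have, in $\mathbb{Z}_2$, \[ \tau^{c_1}_{c_lc_2}+\tau^{c_2}_{c_1c_3}+\cdots+\tau^{c_i}_{c_{i-1}c_{i+1}}+\cdots+\tau^{c_l}_{c_{l-1}c_1}=l\binom{n}{2}. \]
   Context: An orthogonal array $\mathrm{OA}(k,n)$ on an alphabet $\Lambda$ with $|\Lambda|=n$ is an $n^2\times k$ matrix $A=(a_{r\ell})$ with entries in $\Lambda$ such that in every pair of distinct columns each ordered pair in $\Lambda^2$ occurs in exactly one row. For distinct columns $c,i,j\in\{1,\dots,k\}$ and $s\in\Lambda$, let $\rho_s(c,i,j)$ be the permutation of $\Lambda$ mapping $a_{ri}\mapsto a_{rj}$ for all rows $r$ with $a_{rc}=s$. With $\pi(\gamma)\in\mathbb{Z}_2$ denoting the parity of a permutation $\gamma$ ($0$ for even, $1$ for odd), define $\tau^c_{ij}=\tau^c_{ij}(A)=\sum_{s\in\Lambda}\pi(\rho_s(c,i,j))\in\mathbb{Z}_2$. *)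

theory Defs
  imports "HOL-Combinatorics.Permutations" "HOL-Library.Z2"
begin

text \<open>Rows of an OA(k,n) are indexed by \<open>{1..n^2}\<close> and columns by \<open>{1..k}\<close>; the values of
  \<open>A\<close> at other indices are irrelevant.\<close>

definition orthogonal_array :: "nat \<Rightarrow> nat \<Rightarrow> 'a set \<Rightarrow> (nat \<Rightarrow> nat \<Rightarrow> 'a) \<Rightarrow> bool" where
  "orthogonal_array k n \<Lambda> A \<longleftrightarrow>
     finite \<Lambda> \<and> card \<Lambda> = n \<and>
     (\<forall>r\<in>{1..n^2}. \<forall>j\<in>{1..k}. A r j \<in> \<Lambda>) \<and>
     (\<forall>i\<in>{1..k}. \<forall>j\<in>{1..k}. i \<noteq> j \<longrightarrow>
        (\<forall>x\<in>\<Lambda>. \<forall>y\<in>\<Lambda>. \<exists>!r. r \<in> {1..n^2} \<and> A r i = x \<and> A r j = y))"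

text \<open>The permutation mapping \<open>A r i\<close> to \<open>A r j\<close> for all rows \<open>r\<close> with \<open>A r c = s\<close>; it is
  extended by the identity outside the alphabet, so that it is a permutation in the sense of
  \<^const>\<open>permutes\<close>.\<close>

definition rho :: "nat \<Rightarrow> 'a set \<Rightarrow> (nat \<Rightarrow> nat \<Rightarrow> 'a) \<Rightarrow> 'a \<Rightarrow> nat \<Rightarrow> nat \<Rightarrow> nat \<Rightarrow> 'a \<Rightarrow> 'a" where
  "rho n \<Lambda> A s c i j x =
     (if x \<in> \<Lambda> then THE y. \<exists>r\<in>{1..n^2}. A r c = s \<and> A r i = x \<and> A r j = y else x)"

definition parity :: "('a \<Rightarrow> 'a) \<Rightarrow> bit" where
  "parity p = (if evenperm p then 0 else 1)"

definition tau :: "nat \<Rightarrow> 'a set \<Rightarrow> (nat \<Rightarrow> nat \<Rightarrow> 'a) \<Rightarrow> nat \<Rightarrow> nat \<Rightarrow> nat \<Rightarrow> bit" where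
  "tau n \<Lambda> A c i j = (\<Sum>s\<in>\<Lambda>. parity (rho n \<Lambda> A s c i j))"

end

theory Submission
  imports Defs
begin

text \<open>Identify the alphabet with \<open>{..<n}\<close>. A pair of distinct columns \<open>i\<close>, \<open>j\<close> orders the rows
  lexicographically by their entries in columns \<open>i\<close>, \<open>j\<close>. Modulo 2, the number of pairs of rows on
  which two orders disagree is additive in the orders. The orders of \<open>(c, i)\<close> and \<open>(c, j)\<close> disagree
  only on rows with equal entry in column \<open>c\<close>, where the disagreements are the inversions of the
  permutations \<open>\<rho>\<^sub>s(c,i,j)\<close>; their number is \<open>\<tau>\<^sup>c\<^sub>i\<^sub>j\<close> modulo 2. The orders of \<open>(i, j)\<close> and \<open>(j, i)\<close>
  disagree on \<open>(n choose 2)\<^sup>2\<close> pairs, which is \<open>n choose 2\<close> modulo 2. Going around the cycle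
  of columns, regroup the sum so that each of the \<open>l\<close> edges \<open>{i, j}\<close> contributes the disagreement
  of \<open>(i, j)\<close> with \<open>(j, i)\<close>.\<close>

section \<open>Disagreements between two orders, counted modulo 2\<close>

lemma of_nat_bit_eq_iff: "(of_nat a :: bit) = of_nat b \<longleftrightarrow> (even a \<longleftrightarrow> even b)"
proof -
  have "(of_nat m :: bit) = (if even m then 0 else 1)" for m
    by (induction m) auto
  then show ?thesis by simp
qed

text \<open>Ordering each pair by increasing \<open>g\<close> records an unordered pair of
  disagreement exactly once. When \<open>g\<close> and \<open>h\<close> are injective, the
  cardinality is the Kendall tau distance of the two orders.\<close>

definition inversions :: "('a \<Rightarrow> nat) \<Rightarrow> ('a \<Rightarrow> nat) \<Rightarrow> 'a set \<Rightarrow> ('a \<times> 'a) set" where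
  "inversions g h S = {(x, y) \<in> S \<times> S. g x < g y \<and> h y < h x}"

lemma finite_inversions: "finite S \<Longrightarrow> finite (inversions g h S)"
  unfolding inversions_def by (rule finite_subset[of _ "S \<times> S"]) auto

lemma card_inversions_commute: "card (inversions g h S) = card (inversions h g S)"
  by (rule bij_betw_same_card[of prod.swap])
    (auto simp: inversions_def bij_betw_def inj_on_def image_iff)

lemma card_inversions_reindex:
  assumes "bij_betw \<phi> S T"
    and "\<And>x. x \<in> S \<Longrightarrow> g x = g' (\<phi> x)" and "\<And>x. x \<in> S \<Longrightarrow> h x = h' (\<phi> x)"
  shows "card (inversions g h S) = card (inversions g' h' T)"
proof (rule bij_betw_same_card[of "map_prod \<phi> \<phi>"])
  have "inj_on (map_prod \<phi> \<phi>) (S \<times> S)"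
    using assms(1) by (auto simp: bij_betw_def intro: map_prod_inj_on)
  then have "inj_on (map_prod \<phi> \<phi>) (inversions g h S)"
    by (rule inj_on_subset) (auto simp: inversions_def)
  moreover have "map_prod \<phi> \<phi> ` inversions g h S = inversions g' h' T"
    using assms by (force simp: inversions_def bij_betw_def)
  ultimately show "bij_betw (map_prod \<phi> \<phi>) (inversions g h S) (inversions g' h' T)"
    by (simp add: bij_betw_def)
qed

lemma inversions_triangle:
  assumes "finite S" "inj_on g S" "inj_on h S" "inj_on u S"
  shows "(of_nat (card (inversions g u S)) :: bit)
    = of_nat (card (inversions g h S)) + of_nat (card (inversions h u S))"
proof -
  let ?P = "inversions g u S" and ?Q = "inversions g h S" and ?R = "inversions h u S"
  note fin = finite_inversions[OF assms(1)]
  have nless: "\<not> v x < v y \<longleftrightarrow> x = y \<or> v y < v x"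
    if "inj_on v S" "x \<in> S" "y \<in> S" for v :: "'a \<Rightarrow> nat" and x y
    using that by (auto simp: not_less le_less dest: inj_onD)
  note nless = nless[OF assms(2)] nless[OF assms(3)] nless[OF assms(4)]
  \<comment> \<open>If \<open>g\<close> and \<open>u\<close> disagree on a pair, then its members
    are distinct, and \<open>h\<close>, being injective, disagrees with exactly one of
    \<open>g\<close> and \<open>u\<close>.\<close>
  have P: "?P = (?P \<inter> ?Q) \<union> (?P \<inter> ?R)" "(?P \<inter> ?Q) \<inter> (?P \<inter> ?R) = {}"
    using nless(2) by (fastforce simp: inversions_def)+
  have Q: "card ?Q = card (?P \<inter> ?Q) + card (?Q - ?P)"
    by (metis Int_commute card_Int_Diff fin)
  have R: "card ?R = card (?P \<inter> ?R) + card (?R - ?P)"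
    by (metis Int_commute card_Int_Diff fin)
  \<comment> \<open>The leftover pairs are those on which \<open>h\<close> disagrees with both
    \<open>g\<close> and \<open>u\<close>. Each occurs in \<open>?Q\<close> and, with its entries
    swapped, in \<open>?R\<close>, so the two leftovers cancel modulo 2.\<close>
  have "?Q - ?P = {(x, y) \<in> S \<times> S. g x < g y \<and> h y < h x \<and> u x < u y}"
    using nless(3) by (auto simp: inversions_def)
  moreover have "?R - ?P = {(x, y) \<in> S \<times> S. h x < h y \<and> u y < u x \<and> g y < g x}"
    using nless(1) by (auto simp: inversions_def)
  ultimately have "bij_betw prod.swap (?Q - ?P) (?R - ?P)"
    by (auto simp: bij_betw_def inj_on_def image_iff)
  then have "card (?Q - ?P) = card (?R - ?P)"
    by (rule bij_betw_same_card)
  moreover have "card ?P = card (?P \<inter> ?Q) + card (?P \<inter> ?R)"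
    using P fin by (metis card_Un_disjoint finite_Int)
  ultimately have "even (card ?P) \<longleftrightarrow> even (card ?Q + card ?R)"
    using Q R by auto
  then show ?thesis
    by (simp only: of_nat_add[symmetric] of_nat_bit_eq_iff)
qed

section \<open>The parity of a permutation as an inversion count\<close>

lemma odd_inversions_transpose:
  assumes "finite S" "inj_on f S" "a \<in> S" "b \<in> S" "f a < f b"
  shows "odd (card (inversions f (f \<circ> transpose a b) S))"
proof -
  define M where "M = {x \<in> S. f a < f x \<and> f x < f b}"
  have fin: "finite M" using assms(1) by (simp add: M_def)
  have eq: "f x = f y \<longleftrightarrow> x = y" if "x \<in> S" "y \<in> S" for x y
    using assms(2) that by (auto dest: inj_onD)
  \<comment> \<open>Besides \<open>(a, b)\<close> itself, each \<open>x\<close> with value strictly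
    between those of \<open>a\<close> and \<open>b\<close> is inverted once with \<open>a\<close>
    and once with \<open>b\<close>.\<close>
  have "inversions f (f \<circ> transpose a b) S
      = insert (a, b) (Pair a ` M \<union> (\<lambda>x. (x, b)) ` M)"
    using assms(3-5) by (fastforce simp: inversions_def M_def transpose_def
      image_iff split: if_splits)
  moreover have "card (Pair a ` M \<union> (\<lambda>x. (x, b)) ` M) = card M + card M"
    by (subst card_Un_disjoint)
      (use fin in \<open>auto simp: M_def card_image inj_on_def\<close>)
  moreover have "(a, b) \<notin> Pair a ` M \<union> (\<lambda>x. (x, b)) ` M"
    by (auto simp: M_def)
  ultimately show ?thesis
    using fin by simp
qed

text \<open>Build \<open>p\<close> from transpositions. Relabelling the elements by \<open>p\<close>
  shows that the orders \<open>f \<circ> p\<close> and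
  \<open>f \<circ> (transpose a b \<circ> p)\<close> have an odd number of disagreements, so by the
  triangle identity each new transposition flips the parity of the count.\<close>

lemma parity_eq_inversions:
  assumes "finite S" "inj_on f S" "p permutes S"
  shows "parity p = of_nat (card (inversions f (f \<circ> p) S))"
  using assms(3,1)
proof (induction p rule: permutes_induct)
  case id
  have "inversions f f S = {}" by (auto simp: inversions_def)
  then show ?case by (simp add: parity_def)
next
  case (swap a b p)
  have perm: "permutation p"
    using swap.hyps assms(1) by (auto simp: permutation_permutes)
  have tr: "transpose a b permutes S"
    using swap.hyps by (simp add: permutes_swap_id)
  have inj: "inj_on (f \<circ> q) S" if "q permutes S" for q
    using permutes_inj_on[OF that] permutes_image[OF that] assms(2) by (metis comp_inj_on)
  have "odd (card (inversions f (f \<circ> transpose a b) S))"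
  proof (cases "f a < f b")
    case True
    then show ?thesis using odd_inversions_transpose[OF assms(1,2) swap.hyps(1,2)] by simp
  next
    case False
    then have "f b < f a"
      using swap.hyps assms(2) by (metis inj_onD linorder_neqE_nat)
    then show ?thesis
      using odd_inversions_transpose[OF assms(1,2) swap.hyps(2,1)]
      by (simp add: transpose_commute)
  qed
  moreover have "card (inversions (f \<circ> p) (f \<circ> (transpose a b \<circ> p)) S)
      = card (inversions f (f \<circ> transpose a b) S)"
    by (rule card_inversions_reindex[of p])
      (use swap.hyps in \<open>auto simp: permutes_imp_bij\<close>)
  ultimately have "odd (card (inversions (f \<circ> p) (f \<circ> (transpose a b \<circ> p)) S))"
    by simp
  then have "of_nat (card (inversions f (f \<circ> (transpose a b \<circ> p)) S))
      = of_nat (card (inversions f (f \<circ> p) S)) + (1 :: bit)"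
    using inversions_triangle[OF assms(1,2) inj inj, of p "transpose a b \<circ> p"]
      permutes_compose[OF swap.hyps(4) tr] swap.hyps(4) of_nat_bit_eq_iff[of _ 1]
    by simp
  moreover have "parity (transpose a b \<circ> p) = parity p + 1"
    using perm swap.hyps
    by (simp add: parity_def evenperm_comp evenperm_swap permutation_swap_id)
  ultimately show ?case
    using swap.IH assms(1) by (simp only:)
qed

section \<open>Two-digit comparison in base \<open>n\<close>, and increasing pairs\<close>

lemma mult_add_less_iff:
  fixes a a' b b' n :: nat
  assumes "b < n" "b' < n"
  shows "a * n + b < a' * n + b' \<longleftrightarrow> a < a' \<or> a = a' \<and> b < b'"
proof -
  have "a * n + b < a' * n + b'" if "a < a'" "b < n" for a a' b b' :: nat
  proof -
    have "Suc a * n \<le> a' * n" using that by (intro mult_le_mono1) simp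
    then show ?thesis using that by simp
  qed
  from this[of a a' b b'] this[of a' a b' b] show ?thesis
    using assms by (cases a a' rule: linorder_cases) auto
qed

lemma card_less_pairs: "card {(a, b). a < b \<and> b < n} = n choose 2"
proof (induction n)
  case (Suc n)
  have "{(a, b). a < b \<and> b < Suc n} = {(a, b). a < b \<and> b < n} \<union> (\<lambda>a. (a, n)) ` {..<n}"
    by (auto simp: less_Suc_eq)
  moreover have "finite {(a, b). a < b \<and> b < n}"
    by (rule finite_subset[of _ "{..<n} \<times> {..<n}"]) auto
  moreover have "{(a, b). a < b \<and> b < n} \<inter> (\<lambda>a. (a, n)) ` {..<n} = {}"
    by auto
  ultimately have "card {(a, b). a < b \<and> b < Suc n} = (n choose 2) + n"
    using Suc by (simp add: card_Un_disjoint card_image inj_on_def)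
  then show ?case by (simp add: numeral_2_eq_2)
qed simp

section \<open>Rows of the array ordered by two of its columns\<close>

locale numbered_orthogonal_array =
  fixes k n :: nat and \<Lambda> :: "'a set" and A :: "nat \<Rightarrow> nat \<Rightarrow> 'a" and f :: "'a \<Rightarrow> nat"
  assumes array: "orthogonal_array k n \<Lambda> A"
    and numbering: "bij_betw f \<Lambda> {..<n}"
begin

abbreviation rows :: "nat set" where
  "rows \<equiv> {1..n\<^sup>2}"

text \<open>The numeral with digits \<open>f (A r i)\<close> and \<open>f (A r j)\<close> in base
  \<open>n\<close>: comparing ranks is lexicographic comparison, so a row order becomes a function
  to \<open>nat\<close> as \<open>inversions\<close> expects.\<close>

definition lex_rank :: "nat \<Rightarrow> nat \<Rightarrow> nat \<Rightarrow> nat" where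
  "lex_rank i j r = f (A r i) * n + f (A r j)"

lemma finite_alphabet: "finite \<Lambda>"
  using array by (simp add: orthogonal_array_def)

lemma entry_in_alphabet: "r \<in> rows \<Longrightarrow> j \<in> {1..k} \<Longrightarrow> A r j \<in> \<Lambda>"
  using array by (simp add: orthogonal_array_def)

lemma ex1_row:
  assumes "i \<in> {1..k}" "j \<in> {1..k}" "i \<noteq> j" "x \<in> \<Lambda>" "y \<in> \<Lambda>"
  shows "\<exists>!r. r \<in> rows \<and> A r i = x \<and> A r j = y"
  using array assms unfolding orthogonal_array_def by blast

lemma row_eqI:
  assumes "i \<in> {1..k}" "j \<in> {1..k}" "i \<noteq> j" "r \<in> rows" "r' \<in> rows"
    and "A r i = A r' i" "A r j = A r' j"
  shows "r = r'"
  using ex1_row[OF assms(1-3), of "A r i" "A r j"] assms entry_in_alphabet by metis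

lemma inj_numbering: "inj_on f \<Lambda>"
  using numbering by (simp add: bij_betw_def)

lemma numbering_less: "r \<in> rows \<Longrightarrow> j \<in> {1..k} \<Longrightarrow> f (A r j) < n"
  using numbering entry_in_alphabet bij_betwE by blast

lemma numbering_eq_iff:
  "r \<in> rows \<Longrightarrow> r' \<in> rows \<Longrightarrow> j \<in> {1..k} \<Longrightarrow> f (A r j) = f (A r' j) \<longleftrightarrow> A r j = A r' j"
  using inj_numbering entry_in_alphabet by (metis inj_onD)

lemma lex_rank_less_iff:
  assumes "i \<in> {1..k}" "j \<in> {1..k}" "r \<in> rows" "r' \<in> rows"
  shows "lex_rank i j r < lex_rank i j r' \<longleftrightarrow>
    f (A r i) < f (A r' i) \<or> A r i = A r' i \<and> f (A r j) < f (A r' j)"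
  unfolding lex_rank_def using assms
  by (simp only: mult_add_less_iff numbering_less numbering_eq_iff)

lemma inj_lex_rank:
  assumes "i \<in> {1..k}" "j \<in> {1..k}" "i \<noteq> j"
  shows "inj_on (lex_rank i j) rows"
proof (rule inj_onI)
  fix r r' assume r: "r \<in> rows" "r' \<in> rows" and "lex_rank i j r = lex_rank i j r'"
  then have "\<not> lex_rank i j r < lex_rank i j r'" "\<not> lex_rank i j r' < lex_rank i j r"
    by simp_all
  then have "f (A r i) = f (A r' i)" "f (A r j) = f (A r' j)"
    unfolding lex_rank_less_iff[OF assms(1,2) r] lex_rank_less_iff[OF assms(1,2) r(2,1)]
    using numbering_eq_iff[OF r assms(1)] by auto
  then show "r = r'"
    using r assms row_eqI numbering_eq_iff by blast
qed

lemma bij_betw_entries: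
  assumes "i \<in> {1..k}" "j \<in> {1..k}" "i \<noteq> j"
  shows "bij_betw (\<lambda>r. (f (A r i), f (A r j))) rows ({..<n} \<times> {..<n})"
proof (rule bij_betw_imageI)
  show "inj_on (\<lambda>r. (f (A r i), f (A r j))) rows"
    using assms row_eqI numbering_eq_iff by (intro inj_onI) blast
  show "(\<lambda>r. (f (A r i), f (A r j))) ` rows = {..<n} \<times> {..<n}"
  proof (intro equalityI subsetI)
    fix z assume "z \<in> {..<n} \<times> {..<n}"
    then obtain x y where "x \<in> \<Lambda>" "y \<in> \<Lambda>" "z = (f x, f y)"
      using bij_betw_imp_surj_on[OF numbering] by blast
    then show "z \<in> (\<lambda>r. (f (A r i), f (A r j))) ` rows"
      using ex1_row[OF assms, of x y] by blast
  qed (use assms numbering_less in auto)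
qed

text \<open>Columns \<open>i\<close> and \<open>j\<close> identify the rows with the points of an
  \<open>n\<close> by \<open>n\<close> grid. Two points are inverted exactly when one coordinate
  strictly increases and the other strictly decreases, and these two conditions are chosen
  independently.\<close>

lemma card_inversions_flip:
  assumes "i \<in> {1..k}" "j \<in> {1..k}" "i \<noteq> j"
  shows "card (inversions (lex_rank i j) (lex_rank j i) rows) = (n choose 2)\<^sup>2"
proof -
  let ?g = "\<lambda>(a, b). a * n + b" and ?h = "\<lambda>(a, b). b * n + a"
  let ?L = "{(a, b). a < b \<and> b < n}"
  have "card (inversions (lex_rank i j) (lex_rank j i) rows)
      = card (inversions ?g ?h ({..<n} \<times> {..<n}))"
    by (rule card_inversions_reindex[OF bij_betw_entries[OF assms]]) (simp_all add: lex_rank_def)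
  also have "\<dots> = card (?L \<times> ?L)"
  proof (rule bij_betw_same_card)
    show "bij_betw (\<lambda>((a, b), (a', b')). ((a, a'), (b', b)))
        (inversions ?g ?h ({..<n} \<times> {..<n})) (?L \<times> ?L)"
      by (rule bij_betw_byWitness[where f' = "\<lambda>((a, a'), (b', b)). ((a, b), (a', b'))"])
        (auto simp: inversions_def mult_add_less_iff)
  qed
  finally show ?thesis
    by (simp add: card_cartesian_product card_less_pairs power2_eq_square)
qed

section \<open>Expressing \<open>tau\<close> through row orders\<close>

lemma bij_betw_column:
  assumes "c \<in> {1..k}" "i \<in> {1..k}" "c \<noteq> i" "s \<in> \<Lambda>"
  shows "bij_betw (\<lambda>r. A r i) {r \<in> rows. A r c = s} \<Lambda>"
proof (rule bij_betw_imageI)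
  show "inj_on (\<lambda>r. A r i) {r \<in> rows. A r c = s}"
    by (intro inj_onI row_eqI[OF assms(1-3)]) simp_all
  show "(\<lambda>r. A r i) ` {r \<in> rows. A r c = s} = \<Lambda>"
  proof (intro equalityI subsetI)
    fix x assume "x \<in> \<Lambda>"
    then obtain r where "r \<in> rows \<and> A r c = s \<and> A r i = x"
      using ex1_row[OF assms] by meson
    then show "x \<in> (\<lambda>r. A r i) ` {r \<in> rows. A r c = s}"
      by blast
  qed (use entry_in_alphabet[OF _ assms(2)] in auto)
qed

lemma rho_entry:
  assumes "c \<in> {1..k}" "i \<in> {1..k}" "c \<noteq> i" "r \<in> rows"
  shows "rho n \<Lambda> A (A r c) c i j (A r i) = A r j"
proof -
  have "(THE y. \<exists>r'\<in>rows. A r' c = A r c \<and> A r' i = A r i \<and> A r' j = y) = A r j"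
  proof (rule the_equality)
    show "\<exists>r'\<in>rows. A r' c = A r c \<and> A r' i = A r i \<and> A r' j = A r j"
      using assms(4) by blast
  qed (use row_eqI[OF assms(1-3) _ assms(4)] in blast)
  then show ?thesis
    using assms entry_in_alphabet by (simp add: rho_def)
qed

text \<open>On the rows with entry \<open>s\<close> in column \<open>c\<close>, following the column
  \<open>i\<close> bijection by \<open>rho\<close> gives the column \<open>j\<close>
  bijection.\<close>

lemma rho_permutes:
  assumes "c \<in> {1..k}" "i \<in> {1..k}" "j \<in> {1..k}" "c \<noteq> i" "c \<noteq> j" "s \<in> \<Lambda>"
  shows "rho n \<Lambda> A s c i j permutes \<Lambda>"
proof (rule bij_imp_permutes)
  let ?R = "{r \<in> rows. A r c = s}"
  have "bij_betw (rho n \<Lambda> A s c i j \<circ> (\<lambda>r. A r i)) ?R \<Lambda>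
      \<longleftrightarrow> bij_betw (\<lambda>r. A r j) ?R \<Lambda>"
    using assms rho_entry by (intro bij_betw_cong) auto
  then show "bij_betw (rho n \<Lambda> A s c i j) \<Lambda> \<Lambda>"
    using bij_betw_column[OF assms(1,3,5,6)]
      bij_betw_comp_iff[OF bij_betw_column[OF assms(1,2,4,6)]] by blast
qed (simp add: rho_def)

text \<open>Both ranks compare column \<open>c\<close> first, so inversions lie within the fibres
  \<open>R s\<close>. Reading column \<open>i\<close> identifies a fibre with the alphabet and
  carries the order by column \<open>j\<close> to
  \<open>f \<circ> rho n \<Lambda> A s c i j\<close>.\<close>

lemma tau_eq_inversions:
  assumes "c \<in> {1..k}" "i \<in> {1..k}" "j \<in> {1..k}" "c \<noteq> i" "c \<noteq> j"
  shows "tau n \<Lambda> A c i j = of_nat (card (inversions (lex_rank c i) (lex_rank c j) rows))"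
proof -
  define R where "R s = {r \<in> rows. A r c = s}" for s
  define I where "I s = inversions (\<lambda>r. f (A r i)) (\<lambda>r. f (A r j)) (R s)" for s
  have par: "parity (rho n \<Lambda> A s c i j) = of_nat (card (I s))" if "s \<in> \<Lambda>" for s
  proof -
    have "card (I s) = card (inversions f (f \<circ> rho n \<Lambda> A s c i j) \<Lambda>)"
      unfolding I_def R_def
      by (rule card_inversions_reindex[OF bij_betw_column[of c i s]])
        (use that assms rho_entry in auto)
    then show ?thesis
      using parity_eq_inversions[OF finite_alphabet inj_numbering rho_permutes] assms that
      by simp
  qed
  have "inversions (lex_rank c i) (lex_rank c j) rows = (\<Union>s\<in>\<Lambda>. I s)"
    using assms entry_in_alphabet
    by (auto simp: inversions_def I_def R_def lex_rank_less_iff simp del: atLeastAtMost_iff)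
  moreover have "card (\<Union>s\<in>\<Lambda>. I s) = (\<Sum>s\<in>\<Lambda>. card (I s))"
  proof (rule card_UN_disjoint)
    show "\<forall>s\<in>\<Lambda>. finite (I s)"
      by (simp add: I_def R_def finite_inversions)
    show "\<forall>s\<in>\<Lambda>. \<forall>t\<in>\<Lambda>. s \<noteq> t \<longrightarrow> I s \<inter> I t = {}"
      by (auto simp: I_def R_def inversions_def)
  qed (rule finite_alphabet)
  ultimately show ?thesis
    by (simp add: tau_def par)
qed

text \<open>The order of the row numbers, given by \<open>id\<close>, serves as a common reference
  point. Each summand then involves a single ordered pair of columns, which makes regrouping around
  the cycle possible.\<close>

lemma tau_eq_sum:
  assumes "c \<in> {1..k}" "i \<in> {1..k}" "j \<in> {1..k}" "c \<noteq> i" "c \<noteq> j"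
  shows "tau n \<Lambda> A c i j = of_nat (card (inversions id (lex_rank c i) rows))
    + of_nat (card (inversions id (lex_rank c j) rows))"
  using inversions_triangle[of rows "lex_rank c i" id "lex_rank c j"] inj_lex_rank assms
  by (simp add: tau_eq_inversions card_inversions_commute[of "lex_rank c i" id])

lemma inversions_id_flip:
  assumes "i \<in> {1..k}" "j \<in> {1..k}" "i \<noteq> j"
  shows "of_nat (card (inversions id (lex_rank i j) rows))
    + of_nat (card (inversions id (lex_rank j i) rows)) = (of_nat (n choose 2) :: bit)"
proof -
  have "of_nat (card (inversions id (lex_rank i j) rows))
      + of_nat (card (inversions id (lex_rank j i) rows))
      = (of_nat (card (inversions (lex_rank i j) (lex_rank j i) rows)) :: bit)"
    using inversions_triangle[of rows "lex_rank i j" id "lex_rank j i"] inj_lex_rank assms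
    by (simp add: card_inversions_commute[of "lex_rank i j" id])
  \<comment> \<open>A square has the same parity as its root.\<close>
  also have "\<dots> = of_nat (n choose 2)"
    unfolding card_inversions_flip[OF assms] of_nat_bit_eq_iff by simp
  finally show ?thesis .
qed

end

section \<open>The sum around the cycle of columns\<close>

theorem lemma2p6:
  fixes n k l :: nat and \<Lambda> :: "'a set" and A :: "nat \<Rightarrow> nat \<Rightarrow> 'a" and c :: "nat \<Rightarrow> nat"
  assumes "n \<ge> 2" and "3 \<le> k" and "k \<le> n + 1" and "l \<ge> 3"
    and "\<And>i. i \<in> {1..l} \<Longrightarrow> c i \<in> {1..k}" and "inj_on c {1..l}"
    and "orthogonal_array k n \<Lambda> A"
  shows "(\<Sum>i = 1..l. tau n \<Lambda> A (c i)
            (c (if i = 1 then l else i - 1)) (c (if i = l then 1 else i + 1)))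
         = of_nat (l * (n choose 2))"
proof -
  obtain f where "bij_betw f \<Lambda> {..<n}"
    using assms(7) by (metis orthogonal_array_def ex_bij_betw_finite_nat lessThan_atLeast0)
  then interpret numbered_orthogonal_array k n \<Lambda> A f
    using assms(7) by unfold_locales
  define prv where "prv i = (if i = 1 then l else i - 1)" for i
  define nxt where "nxt i = (if i = l then 1 else i + 1)" for i
  define F where "F i j = (of_nat (card (inversions id (lex_rank (c i) (c j)) rows)) :: bit)" for i j
  have mem: "prv i \<in> {1..l}" "nxt i \<in> {1..l}" "prv i \<noteq> i" "nxt i \<noteq> i"
    "prv (nxt i) = i" "nxt (prv i) = i" if "i \<in> {1..l}" for i
    using that \<open>l \<ge> 3\<close> by (auto simp: prv_def nxt_def)
  have col: "c (prv i) \<in> {1..k}" "c (nxt i) \<in> {1..k}" "c i \<in> {1..k}"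
    "c i \<noteq> c (prv i)" "c i \<noteq> c (nxt i)" if "i \<in> {1..l}" for i
    using assms(5) mem[OF that] that assms(6) by (auto dest!: inj_onD simp del: atLeastAtMost_iff)
  have "(\<Sum>i = 1..l. tau n \<Lambda> A (c i) (c (prv i)) (c (nxt i)))
      = (\<Sum>i = 1..l. F i (prv i) + F i (nxt i))"
    unfolding F_def by (intro sum.cong refl tau_eq_sum col)
  also have "\<dots> = (\<Sum>i = 1..l. F i (prv i)) + (\<Sum>i = 1..l. F i (nxt i))"
    by (rule sum.distrib)
  \<comment> \<open>Shift the index by one along the cycle: \<open>prv\<close> and
    \<open>nxt\<close> are mutually inverse on \<open>{1..l}\<close>. Each edge from
    \<open>i\<close> to \<open>nxt i\<close> now appears once in each orientation.\<close>
  also have "(\<Sum>i = 1..l. F i (prv i)) = (\<Sum>i = 1..l. F (nxt i) i)"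
    by (rule sum.reindex_bij_witness[of _ nxt prv]) (simp_all only: mem)
  also have "\<dots> + (\<Sum>i = 1..l. F i (nxt i)) = (\<Sum>i = 1..l. F i (nxt i) + F (nxt i) i)"
    by (simp only: sum.distrib add.commute)
  also have "\<dots> = (\<Sum>i = 1..l. of_nat (n choose 2))"
    unfolding F_def by (intro sum.cong refl inversions_id_flip col)
  also have "\<dots> = of_nat (l * (n choose 2))"
    by simp
  finally show ?thesis
    unfolding prv_def nxt_def .
qed

end
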